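(* Let $F$ be a forest of size $n$. Then $$\sum_{w \in \mathcal{W}(F)} q^{\mathrm{inv}(F,w)} \prod_{v \in \mathrm{Btmax}(F,w)} t_v = \frac{n!}{\prod_{v \in V(F)} h_v} \prod_{v \in V(F)} \left([h_v]-1+t_v\right),$$ $$\sum_{w \in \mathcal{W}_B(F)} q^{\mathrm{inv}_B(F,w)} \prod_{v \in \mathrm{Btmax}_B(F,w)} t_v = \frac{n!}{\prod_{v \in V(F)} h_v} \prod_{v \in V(F)} \left([2h_v]-1+t_v\right),$$ $$\sum_{w \in \mathcal{W}_D(F)} q^{\mathrm{inv}_D(F,w)} \prod_{v \in \mathrm{Btmax}_D(F,w)} t_v = \frac{n!\cdot 2^{\#\{\text{leaves in }F\}-1}}{\prod_{v \in V(F)} h_v} \prod_{\substack{v \in V(F)\\ v \text{ is not a leaf}}} \left((1+q^{h_v-1})[h_v]-1+t_v\right).$$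
   Context: $F$ is a finite rooted plane forest with vertex set $V(F)=\{v_1,\dots,v_n\}$, $n\ge 1$. It is drawn with roots on top and regarded as the Hasse diagram of the poset $(V(F),<_F)$: $u<_F v$ means that $u\ne v$ and $u$ is a descendant of $v$. The vertices are naturally indexed: $v_i<_F v_j$ implies $i<j$. For a vertex $v$, $h_v$ is the number of vertices of the subtree rooted at $v$, i.e. $h_v=\#\{u: u\le_F v\}$. A leaf is a vertex with no vertex below it. $\mathcal{W}(F)$ is the set of labelings of $F$, i.e. bijections $w:V(F)\to\{1,\dots,n\}$. $\mathcal{W}_B(F)$ is the set of signed labelings, i.e. injective maps $w:V(F)\to\{\pm1,\dots,\pm n\}$ such that $i\in w(V(F))$ implies $-i\notin w(V(F))$. $\mathcal{W}_D(F)\subseteq \mathcal{W}_B(F)$ is the set of even-signed labelings, those with an even number of negative labels. For a (signed) labeling $w$: $\mathrm{inv}(F,w)=\#\{(u,v):u<_F v,\ w(u)>w(v)\}$; $n_1(F,w)$ is the number of negative labels of $w$; $n_2(F,w)=\#\{(x,y):x<_F y,\ w(x)+w(y)<0\}$; $\mathrm{inv}_B(F,w)=\mathrm{inv}(F,w)+n_1(F,w)+n_2(F,w)$; $\mathrm{inv}_D(F,w)=\mathrm{inv}(F,w)+n_2(F,w)$. Bottom-to-top maximum positions: for $w\in\mathcal{W}(F)$, $\mathrm{Btmax}(F,w)=\{v: w(v)>w(u)\text{ for all }u<_F v\}$; for $w\in\mathcal{W}_B(F)$, $\mathrm{Btmax}_B(F,w)=\{v: w(v)>0\text{ and }w(v)>|w(u)|\text{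 for all }u<_F v\}$; for $w\in\mathcal{W}_D(F)$, $\mathrm{Btmax}_D(F,w)=\{v: v\text{ is not a leaf},\ w(v)>0\text{ and }w(v)>|w(u)|\text{ for all }u<_F v\}$. $[m]=1+q+\cdots+q^{m-1}$; $q$ and $t_v$ ($v\in V(F)$) are commuting indeterminates. *)

theory Defs
  imports Complex_Main "HOL-Library.FuncSet" "HOL-Library.Poly_Mapping"
begin

section \<open>Plane forests\<close>

text \<open>
  A plane forest is a list of plane trees.  The vertices are the node labels, so an actual
  forest is one in which no vertex occurs twice (\<open>plane_forest\<close> below).
  Descendants of \<open>v\<close> are the other vertices of the subtree with top vertex \<open>v\<close>.
\<close>

datatype (verts_tree: 'a) plane_tree = Node (top_vertex: 'a) (children: "'a plane_tree list")

type_synonym 'a forest = "'a plane_tree list"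

fun preorder :: "'a plane_tree \<Rightarrow> 'a list" where
  "preorder (Node v ts) = v # concat (map preorder ts)"

fun subtrees :: "'a plane_tree \<Rightarrow> 'a plane_tree set" where
  "subtrees (Node v ts) = insert (Node v ts) (\<Union>t\<in>set ts. subtrees t)"

definition plane_forest :: "'a forest \<Rightarrow> bool" where
  "plane_forest F \<longleftrightarrow> distinct (concat (map preorder F))"

definition verts :: "'a forest \<Rightarrow> 'a set" where
  "verts F = (\<Union>t\<in>set F. verts_tree t)"

definition below :: "'a forest \<Rightarrow> 'a \<Rightarrow> 'a \<Rightarrow> bool" where
  "below F u v \<longleftrightarrow> u \<noteq> v \<and>
     (\<exists>t\<in>set F. \<exists>s\<in>subtrees t. top_vertex s = v \<and> u \<in> verts_tree s)"

definition hook :: "'a forest \<Rightarrow> 'a \<Rightarrow> nat" where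
  "hook F v = card {u \<in> verts F. below F u v \<or> u = v}"

definition leaf :: "'a forest \<Rightarrow> 'a \<Rightarrow> bool" where
  "leaf F v \<longleftrightarrow> v \<in> verts F \<and> \<not> (\<exists>u. below F u v)"


section \<open>Labelings\<close>

text \<open>
  Labelings are taken to be \<^const>\<open>undefined\<close> outside the vertex set (\<open>\<rightarrow>\<^sub>E\<close>), so that each map
  on the vertices is counted exactly once.
\<close>

definition labelings :: "'a forest \<Rightarrow> ('a \<Rightarrow> int) set" where
  "labelings F = {w \<in> verts F \<rightarrow>\<^sub>E {1..int (card (verts F))}.
     bij_betw w (verts F) {1..int (card (verts F))}}"

definition labelings_B :: "'a forest \<Rightarrow> ('a \<Rightarrow> int) set" where
  "labelings_B F = {w \<in> verts F \<rightarrow>\<^sub>E {- int (card (verts F))..int (card (verts F))} - {0}.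
     inj_on w (verts F) \<and> (\<forall>i. i \<in> w ` verts F \<longrightarrow> - i \<notin> w ` verts F)}"

definition n1 :: "'a forest \<Rightarrow> ('a \<Rightarrow> int) \<Rightarrow> nat" where
  "n1 F w = card {v \<in> verts F. w v < 0}"

definition labelings_D :: "'a forest \<Rightarrow> ('a \<Rightarrow> int) set" where
  "labelings_D F = {w \<in> labelings_B F. even (n1 F w)}"

definition inv_F :: "'a forest \<Rightarrow> ('a \<Rightarrow> int) \<Rightarrow> nat" where
  "inv_F F w = card {(u, v). below F u v \<and> w u > w v}"

definition n2 :: "'a forest \<Rightarrow> ('a \<Rightarrow> int) \<Rightarrow> nat" where
  "n2 F w = card {(x, y). below F x y \<and> w x + w y < 0}"

definition inv_B :: "'a forest \<Rightarrow> ('a \<Rightarrow> int) \<Rightarrow> nat" where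
  "inv_B F w = inv_F F w + n1 F w + n2 F w"

definition inv_D :: "'a forest \<Rightarrow> ('a \<Rightarrow> int) \<Rightarrow> nat" where
  "inv_D F w = inv_F F w + n2 F w"

definition Btmax :: "'a forest \<Rightarrow> ('a \<Rightarrow> int) \<Rightarrow> 'a set" where
  "Btmax F w = {v \<in> verts F. \<forall>u. below F u v \<longrightarrow> w v > w u}"

definition Btmax_B :: "'a forest \<Rightarrow> ('a \<Rightarrow> int) \<Rightarrow> 'a set" where
  "Btmax_B F w = {v \<in> verts F. w v > 0 \<and> (\<forall>u. below F u v \<longrightarrow> w v > \<bar>w u\<bar>)}"

definition Btmax_D :: "'a forest \<Rightarrow> ('a \<Rightarrow> int) \<Rightarrow> 'a set" where
  "Btmax_D F w =
     {v \<in> verts F. \<not> leaf F v \<and> w v > 0 \<and> (\<forall>u. below F u v \<longrightarrow> w v > \<bar>w u\<bar>)}"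


section \<open>The polynomial ring in q and the t_v over the rationals\<close>

datatype 'a indet = Q | T 'a

type_synonym 'a qt_poly = "('a indet \<Rightarrow>\<^sub>0 nat) \<Rightarrow>\<^sub>0 rat"

text \<open>
  Monomials are finitely supported exponent functions, polynomials are finitely supported
  coefficient functions on monomials; multiplication in \<open>qt_poly\<close> is the
  convolution product of \<^theory>\<open>HOL-Library.Poly_Mapping\<close>.
\<close>

definition indeterminate :: "'a indet \<Rightarrow> 'a qt_poly" where
  "indeterminate x = Poly_Mapping.single (Poly_Mapping.single x 1) 1"

definition const_poly :: "rat \<Rightarrow> 'a qt_poly" where
  "const_poly c = Poly_Mapping.single 0 c"

abbreviation q_var :: "'a qt_poly" where
  "q_var \<equiv> indeterminate Q"

abbreviation t_var :: "'a \<Rightarrow> 'a qt_poly" where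
  "t_var v \<equiv> indeterminate (T v)"

definition q_number :: "nat \<Rightarrow> 'a qt_poly" where
  "q_number m = (\<Sum>i<m. q_var ^ i)"

end

theory Submission
  imports Defs
begin

text \<open>
  For a labeling \<open>s\<close> let \<open>r v\<close> be the number of vertices below \<open>v\<close> with a larger label than \<open>v\<close>
  (\<open>larger_below\<close>).  All three formulas come from one fact (\<open>sum_prod_larger_below\<close>): for a
  uniformly random labeling of a forest the numbers \<open>r v\<close> are independent, with \<open>r v\<close> uniform
  on \<open>{0, ..., h - 1}\<close> for \<open>h = hook F v\<close>.  Equivalently, the sum over all labelings of a product
  of functions of the \<open>r v\<close> is the product over \<open>v\<close> of the sums over \<open>r < h\<close>, multiplied by
  \<open>n!\<close> divided by the product of the hook lengths.

  It remains to write each weight as such a product.  For ordinary labelings \<open>inv_F\<close> is the sum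
  of the \<open>r v\<close>, and \<open>v\<close> is a bottom-to-top maximum exactly when \<open>r v = 0\<close>.  So \<open>v\<close> contributes
  \<open>q ^ r\<close>, replaced by \<open>t_v\<close> for \<open>r = 0\<close>, and these sum to \<open>[h] - 1 + t_v\<close>.

  A signed labeling is a labeling \<open>s\<close> (the absolute values) together with the set \<open>N\<close> of
  vertices with negative label.  Once \<open>s\<close> is fixed, the contribution of \<open>v\<close> depends only on
  whether \<open>v \<in> N\<close> (\<open>inv_F_plus_n2_with_signs\<close>): a positive label contributes as before, except
  that a leaf carries no \<open>t_v\<close> in the third formula, and a negative one gives
  \<open>q ^ (2 * h - 1 - r)\<close> for \<open>inv_B\<close> and \<open>q ^ (2 * h - 2 - r)\<close> for \<open>inv_D\<close>.  Hence the sum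
  over \<open>N\<close> factorizes over the vertices, and the independence applies to the factors
  \<open>negative + positive\<close>, whose sums over \<open>r\<close> are the factors of the second and third formula, with
  a factor 2 for each leaf in the third.  In the third formula only sets \<open>N\<close> of even size
  are admitted; since the sign at a leaf has no influence on the weight, this halves the sum
  (\<open>sum_even_Pow_signs\<close>).
\<close>

section \<open>Bijections on a disjoint union\<close>

definition bijections :: "'a set \<Rightarrow> 'b set \<Rightarrow> ('a \<Rightarrow> 'b) set" where
  "bijections V A = {s \<in> extensional V. bij_betw s V A}"

lemma finite_bijections:
  assumes "finite V" "finite A"
  shows "finite (bijections V A)"
proof (rule finite_subset)
  show "bijections V A \<subseteq> V \<rightarrow>\<^sub>E A"
    by (auto simp: bijections_def PiE_def Pi_def bij_betw_def)
  show "finite (V \<rightarrow>\<^sub>E A)" using assms by (simp add: finite_PiE)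
qed

text \<open>
  A bijection on \<open>V1 \<union> V2\<close> is the choice of the set \<open>S\<close> of labels used on \<open>V1\<close>, followed by
  independent bijections \<open>V1 \<rightarrow> S\<close> and \<open>V2 \<rightarrow> A - S\<close>.  Label sets are kept arbitrary so that
  neither part has to be standardized to an initial segment of the integers.
\<close>

lemma sum_bijections_disjoint_union:
  fixes g1 g2 :: "('a \<Rightarrow> 'b) \<Rightarrow> 'c::comm_semiring_1"
  assumes disj: "V1 \<inter> V2 = {}" and fin: "finite V1" "finite V2" "finite A"
    and g1: "\<And>s s'. (\<And>v. v \<in> V1 \<Longrightarrow> s v = s' v) \<Longrightarrow> g1 s = g1 s'"
    and g2: "\<And>s s'. (\<And>v. v \<in> V2 \<Longrightarrow> s v = s' v) \<Longrightarrow> g2 s = g2 s'"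
  shows "(\<Sum>s\<in>bijections (V1 \<union> V2) A. g1 s * g2 s) =
    (\<Sum>S | S \<subseteq> A \<and> card S = card V1.
      (\<Sum>s\<in>bijections V1 S. g1 s) * (\<Sum>s\<in>bijections V2 (A - S). g2 s))"
proof -
  have fin1: "finite {S. S \<subseteq> A \<and> card S = card V1}"
    using fin by (auto intro: finite_subset[of _ "Pow A"])
  have finA: "finite S" if "S \<subseteq> A" for S using that fin finite_subset by blast
  let ?B = "SIGMA S:{S. S \<subseteq> A \<and> card S = card V1}. bijections V1 S \<times> bijections V2 (A - S)"
  have "(\<Sum>S | S \<subseteq> A \<and> card S = card V1.
      (\<Sum>s\<in>bijections V1 S. g1 s) * (\<Sum>s\<in>bijections V2 (A - S). g2 s)) =
    (\<Sum>S | S \<subseteq> A \<and> card S = card V1. \<Sum>(a, b)\<in>bijections V1 S \<times> bijections V2 (A - S). g1 a * g2 b)"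
    by (simp add: sum_product sum.cartesian_product)
  also have "\<dots> = (\<Sum>(S, a, b)\<in>?B. g1 a * g2 b)"
    using fin finA fin1 by (subst sum.Sigma) (auto intro!: finite_bijections)
  also have "\<dots> = (\<Sum>s\<in>bijections (V1 \<union> V2) A. g1 s * g2 s)"
  proof (rule sum.reindex_bij_witness[where
      i = "\<lambda>s. (s ` V1, restrict s V1, restrict s V2)" and
      j = "\<lambda>(S, a, b) v. if v \<in> V1 then a v else b v"])
    fix x assume x: "x \<in> ?B"
    obtain S a b where [simp]: "x = (S, a, b)" by (cases x)
    have S: "S \<subseteq> A" "a \<in> extensional V1" "bij_betw a V1 S" "b \<in> extensional V2" "bij_betw b V2 (A - S)"
      using x by (auto simp: bijections_def)
    define s where "s = (\<lambda>v. if v \<in> V1 then a v else b v)"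
    have s1: "bij_betw s V1 S" using S(3) by (rule bij_betw_cong[THEN iffD1, rotated]) (simp add: s_def)
    have s2: "bij_betw s V2 (A - S)" using S(5)
      by (rule bij_betw_cong[THEN iffD1, rotated]) (use disj in \<open>auto simp: s_def\<close>)
    have "bij_betw s (V1 \<union> V2) (S \<union> (A - S))"
      using s1 s2 by (rule bij_betw_combine) auto
    then have "bij_betw s (V1 \<union> V2) A" using S(1) by (simp add: Un_absorb1)
    moreover have "s \<in> extensional (V1 \<union> V2)" using S(2,4) by (auto simp: s_def extensional_def)
    ultimately show "(case x of (S, a, b) \<Rightarrow> \<lambda>v. if v \<in> V1 then a v else b v) \<in> bijections (V1 \<union> V2) A"
      by (simp add: bijections_def s_def)
    have "s ` V1 = S" using s1 by (simp add: bij_betw_def)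
    moreover have "restrict s V1 = a" using S(2) by (auto simp: s_def extensional_def)
    moreover have "restrict s V2 = b" using S(4) disj by (auto simp: s_def extensional_def fun_eq_iff)
    ultimately show "(\<lambda>s. (s ` V1, restrict s V1, restrict s V2)) (case x of (S, a, b) \<Rightarrow> \<lambda>v. if v \<in> V1 then a v else b v) = x"
      by (simp add: s_def)
    have "g1 s = g1 a" by (rule g1) (simp add: s_def)
    moreover have "g2 s = g2 b" by (rule g2) (use disj in \<open>auto simp: s_def\<close>)
    ultimately show "(\<lambda>s. g1 s * g2 s) (case x of (S, a, b) \<Rightarrow> \<lambda>v. if v \<in> V1 then a v else b v) = (case x of (S, a, b) \<Rightarrow> g1 a * g2 b)"
      by (simp add: s_def)
  next
    fix s assume s: "s \<in> bijections (V1 \<union> V2) A"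
    then have b: "bij_betw s (V1 \<union> V2) A" and e: "s \<in> extensional (V1 \<union> V2)" by (auto simp: bijections_def)
    have i: "inj_on s (V1 \<union> V2)" "s ` (V1 \<union> V2) = A" using b by (auto simp: bij_betw_def)
    have "s ` V2 = A - s ` V1" using i disj by (auto simp: inj_on_def)
    moreover have "inj_on s V1" "inj_on s V2" using i(1) by (auto simp: inj_on_Un)
    ultimately show "(s ` V1, restrict s V1, restrict s V2) \<in> ?B"
      using i by (auto simp: bijections_def bij_betw_def inj_on_restrict_eq card_image)
    show "(case (s ` V1, restrict s V1, restrict s V2) of (S, a, b) \<Rightarrow> \<lambda>v. if v \<in> V1 then a v else b v) = s"
      using e by (auto simp: extensional_def fun_eq_iff)
  qed
  finally show ?thesis by simp
qed

text \<open>
  Distinct elements of \<open>A\<close> have distinct numbers of larger elements, so these \<open>card A\<close> numbers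
  exhaust \<open>{..<card A}\<close>.
\<close>

lemma sum_above_rank:
  fixes A :: "'b::linorder set" and f :: "nat \<Rightarrow> 'c::comm_monoid_add"
  assumes "finite A"
  shows "(\<Sum>a\<in>A. f (card {b \<in> A. a < b})) = (\<Sum>r<card A. f r)"
proof -
  let ?r = "\<lambda>a. card {b \<in> A. a < b}"
  have less: "?r b < ?r a" if "a \<in> A" "b \<in> A" "a < b" for a b
    using that assms by (intro psubset_card_mono) auto
  have inj: "inj_on ?r A"
    by (rule linorder_inj_onI) (use less in \<open>fastforce\<close>)+
  have "?r ` A = {..<card A}"
  proof (rule card_subset_eq)
    show "?r ` A \<subseteq> {..<card A}"
      using assms by (auto intro!: psubset_card_mono)
  qed (simp_all add: card_image[OF inj])
  then show ?thesis using sum.reindex[OF inj, of f] by simp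
qed


section \<open>Forests built from smaller forests\<close>

lemma subtree_verts: "s \<in> subtrees t \<Longrightarrow> verts_tree s \<subseteq> verts_tree t"
  by (induction t) auto

lemma below_verts: "below F u v \<Longrightarrow> u \<in> verts F \<and> v \<in> verts F"
  using subtree_verts plane_tree.set_sel(1) unfolding below_def verts_def by fast

lemma finite_verts [simp]: "finite (verts F)"
proof -
  have "finite (verts_tree t)" for t :: "'a plane_tree" by (induction t) auto
  then show ?thesis by (simp add: verts_def)
qed

lemma finite_below [simp]: "finite {u. below F u v \<and> P u}"
  by (rule finite_subset[of _ "verts F"]) (auto dest: below_verts)

lemma verts_append [simp]: "verts (G @ H) = verts G \<union> verts H"
  by (simp add: verts_def)

lemma verts_Node [simp]: "verts [Node v cs] = insert v (verts cs)"
  by (auto simp: verts_def)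

lemma below_append: "below (G @ H) u v \<longleftrightarrow> below G u v \<or> below H u v"
  by (auto simp: below_def)

lemma below_Node: "below [Node v cs] u x \<longleftrightarrow> (x = v \<and> u \<noteq> v \<and> u \<in> verts cs) \<or> below cs u x"
  by (auto simp: below_def verts_def)

lemma set_preorder: "set (preorder t) = verts_tree t"
  by (induction t) auto

lemma plane_forest_append:
  "plane_forest (G @ H) \<longleftrightarrow> plane_forest G \<and> plane_forest H \<and> verts G \<inter> verts H = {}"
  by (simp add: plane_forest_def set_preorder verts_def)

lemma plane_forest_Node: "plane_forest [Node v cs] \<longleftrightarrow> v \<notin> verts cs \<and> plane_forest cs"
  by (auto simp: plane_forest_def set_preorder verts_def)

text \<open>
  Every forest arises from the empty one by adding a common root and by juxtaposition.  The
  first step adds one hook length and keeps all others, the second keeps all of them.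
\<close>

lemma forest_induct [case_names Nil Node append]:
  assumes "P []" "\<And>v cs. P cs \<Longrightarrow> P [Node v cs]" "\<And>G H. P G \<Longrightarrow> P H \<Longrightarrow> P (G @ H)"
  shows "P F"
proof -
  have list: "P ts" if "\<And>t. t \<in> set ts \<Longrightarrow> P [t]" for ts
    using that
  proof (induction ts)
    case (Cons t ts)
    then have "P ([t] @ ts)" by (intro assms(3)) auto
    then show ?case by simp
  qed (simp add: assms(1))
  have "P [t]" for t
    by (induction t) (auto intro: assms(2) list)
  then show ?thesis by (rule list)
qed

lemma hook_eq: "v \<in> verts F \<Longrightarrow> hook F v = Suc (card {u. below F u v})"
proof -
  assume "v \<in> verts F"
  then have "{u \<in> verts F. below F u v \<or> u = v} = insert v {u. below F u v}"
    by (auto dest: below_verts)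
  moreover have "v \<notin> {u. below F u v}" by (simp add: below_def)
  ultimately show ?thesis using finite_below[of F v "\<lambda>_. True"] by (simp add: hook_def)
qed

section \<open>Independence of the local inversion numbers\<close>

definition larger_below :: "'a forest \<Rightarrow> ('a \<Rightarrow> 'b::linorder) \<Rightarrow> 'a \<Rightarrow> nat" where
  "larger_below F s v = card {u. below F u v \<and> s v < s u}"

lemma larger_below_cong:
  assumes "\<And>u. u \<in> verts F \<Longrightarrow> s u = s' u"
  shows "larger_below F s v = larger_below F s' v"
proof -
  have "{u. below F u v \<and> s v < s u} = {u. below F u v \<and> s' v < s' u}"
    using assms by (auto dest: below_verts)
  then show ?thesis by (simp add: larger_below_def)
qed

text \<open>
  In a uniformly random bijective labeling the numbers \<open>larger_below F s v\<close> are independent,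
  and the one at \<open>v\<close> is uniform on \<open>{..<hook F v}\<close>.  At a root \<open>v\<close> of a tree the number
  depends only on the label of \<open>v\<close>, as all other labels lie below; it takes each of the
  \<open>hook F v\<close> possible values once, and whichever label is spent on \<open>v\<close>, the rest is
  labeled with a set of the same size.  For two forests side by side, every one of the
  \<open>card A choose card U\<close> ways to share out the labels gives the same product of sums,
  and the binomial coefficient turns the two factorials into one.
\<close>

lemma sum_prod_larger_below:
  fixes f :: "'a \<Rightarrow> nat \<Rightarrow> 'c::comm_semiring_1" and A :: "'b::linorder set"
  assumes "plane_forest F" "finite A" "card A = card (verts F)"
  shows "of_nat (\<Prod>v\<in>verts F. hook F v) *
      (\<Sum>s\<in>bijections (verts F) A. \<Prod>v\<in>verts F. f v (larger_below F s v)) =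
    of_nat (fact (card (verts F))) * (\<Prod>v\<in>verts F. \<Sum>r<hook F v. f v r)"
  using assms
proof (induction F arbitrary: A rule: forest_induct)
  case Nil
  have "bijections {} A = {\<lambda>_::'a. undefined}"
    using Nil by (auto simp: bijections_def verts_def bij_betw_def)
  then show ?case by (simp add: verts_def)
next
  case (Node v cs)
  define V where "V = verts cs"
  define c where "c = (\<Prod>x\<in>V. \<Sum>r<hook cs x. f x r)"
  have v: "v \<notin> V" and cs: "plane_forest cs"
    using Node.prems(1) by (auto simp: plane_forest_Node V_def)
  have finV: "finite V" by (simp add: V_def)
  have cardA: "card A = Suc (card V)" using Node.prems(3) v finV by (simp add: V_def)
  have nv: "\<not> below cs u v" "\<not> below cs v u" for u using v by (auto dest: below_verts simp: V_def)
  have below_v: "below [Node v cs] u v \<longleftrightarrow> u \<in> V" for u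
    using nv v by (auto simp: below_Node V_def)
  have below_V: "below [Node v cs] u x \<longleftrightarrow> below cs u x" if "x \<in> V" for u x
    using that v by (auto simp: below_Node)
  have hook_v: "hook [Node v cs] v = card A"
    using cardA by (simp add: hook_eq below_v)
  have hook_V: "hook [Node v cs] x = hook cs x" if "x \<in> V" for x
    using that by (simp add: hook_eq below_V V_def)
  have rank_V: "larger_below [Node v cs] s x = larger_below cs s x" if "x \<in> V" for x and s :: "'a \<Rightarrow> 'b"
    using that by (simp add: larger_below_def below_V)
  \<comment> \<open>All labels other than that of \<open>v\<close> sit below \<open>v\<close>.\<close>
  have rank_v: "larger_below [Node v cs] s v = card {b \<in> A. s v < b}"
    if "s \<in> bijections (insert v V) A" for s
  proof -
    have s: "inj_on s (insert v V)" "s ` insert v V = A"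
      using that by (auto simp: bijections_def bij_betw_def)
    have "{b \<in> A. s v < b} = s ` {u \<in> V. s v < s u}" using s(2) by auto
    moreover have "inj_on s {u \<in> V. s v < s u}" using s(1) by (auto simp: inj_on_def)
    ultimately show ?thesis by (simp add: larger_below_def below_v card_image)
  qed
  have IH: "of_nat (\<Prod>x\<in>V. hook cs x) *
      (\<Sum>s\<in>bijections V (A - S). \<Prod>x\<in>V. f x (larger_below cs s x)) = of_nat (fact (card V)) * c"
    if "S \<subseteq> A" "card S = 1" for S
    unfolding V_def c_def
  proof (rule Node.IH[OF cs])
    show "card (A - S) = card (verts cs)"
      using that cardA Node.prems(2) by (simp add: card_Diff_subset finite_subset V_def)
  qed (use Node.prems(2) in simp)
  let ?X = "\<lambda>S. \<Sum>s\<in>bijections {v} S. f v (card {b \<in> A. s v < b})"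
  let ?Y = "\<lambda>S. \<Sum>s\<in>bijections V (A - S). \<Prod>x\<in>V. f x (larger_below cs s x)"
  have "(\<Sum>s\<in>bijections (insert v V) A. \<Prod>x\<in>insert v V. f x (larger_below [Node v cs] s x)) =
      (\<Sum>s\<in>bijections ({v} \<union> V) A. f v (card {b \<in> A. s v < b}) * (\<Prod>x\<in>V. f x (larger_below cs s x)))"
    using v finV by (auto intro!: sum.cong prod.cong simp: rank_v rank_V)
  also have "\<dots> = (\<Sum>S | S \<subseteq> A \<and> card S = card {v}.
      ?X S * ?Y S)"
    by (rule sum_bijections_disjoint_union)
      (use v finV Node.prems(2) in \<open>auto simp: V_def intro!: prod.cong arg_cong[of _ _ "f _"] larger_below_cong\<close>)
  finally have split: "(\<Sum>s\<in>bijections (insert v V) A. \<Prod>x\<in>insert v V. f x (larger_below [Node v cs] s x)) =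
      (\<Sum>S | S \<subseteq> A \<and> card S = 1. ?X S * ?Y S)" by simp
  have "of_nat (\<Prod>x\<in>V. hook cs x) * (\<Sum>s\<in>bijections (insert v V) A. \<Prod>x\<in>insert v V. f x (larger_below [Node v cs] s x)) =
      (\<Sum>S | S \<subseteq> A \<and> card S = 1. ?X S * (of_nat (fact (card V)) * c))"
    unfolding split by (subst sum_distrib_left, rule sum.cong[OF refl], subst mult.left_commute, subst IH) auto
  also have "\<dots> = of_nat (fact (card V)) * c * (\<Sum>S\<in>(\<lambda>a. {a}) ` A. ?X S)"
  proof -
    have "{S. S \<subseteq> A \<and> card S = 1} = (\<lambda>a. {a}) ` A" by (auto simp: card_1_singleton_iff)
    then show ?thesis by (simp add: sum_distrib_left mult_ac)
  qed
  also have "(\<Sum>S\<in>(\<lambda>a. {a}) ` A. ?X S) =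
      (\<Sum>a\<in>A. f v (card {b \<in> A. a < b}))"
  proof -
    have "bijections {v} {a} = {\<lambda>x. if x = v then a else undefined}" for a :: 'b
      by (auto simp: bijections_def bij_betw_def extensional_def fun_eq_iff)
    then show ?thesis by (simp add: sum.reindex)
  qed
  also have "\<dots> = (\<Sum>r<card A. f v r)"
    using Node.prems(2) by (rule sum_above_rank)
  finally have main: "of_nat (\<Prod>x\<in>V. hook cs x) *
      (\<Sum>s\<in>bijections (insert v V) A. \<Prod>x\<in>insert v V. f x (larger_below [Node v cs] s x)) =
      of_nat (fact (card V)) * c * (\<Sum>r<card A. f v r)" .
  have hooks: "(\<Prod>x\<in>insert v V. hook [Node v cs] x) = card A * (\<Prod>x\<in>V. hook cs x)"
    using v finV by (simp add: hook_v hook_V)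
  have sums: "(\<Prod>x\<in>insert v V. \<Sum>r<hook [Node v cs] x. f x r) = (\<Sum>r<card A. f v r) * c"
    using v finV by (simp add: hook_v hook_V c_def)
  have "of_nat (\<Prod>x\<in>insert v V. hook [Node v cs] x) *
      (\<Sum>s\<in>bijections (insert v V) A. \<Prod>x\<in>insert v V. f x (larger_below [Node v cs] s x)) =
      of_nat (card A) * (of_nat (fact (card V)) * c * (\<Sum>r<card A. f v r))"
    unfolding hooks of_nat_mult mult.assoc main ..
  also have "\<dots> = of_nat (fact (card (insert v V))) * (\<Prod>x\<in>insert v V. \<Sum>r<hook [Node v cs] x. f x r)"
  proof -
    have "fact (card (insert v V)) = card A * (fact (card V) :: nat)"
      using v finV cardA by simp
    then show ?thesis unfolding sums by (simp only: of_nat_mult mult_ac)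
  qed
  finally show ?case by (simp add: V_def)
next
  case (append G H)
  define U where "U = verts G"
  define V where "V = verts H"
  define a where "a = (\<Prod>x\<in>U. \<Sum>r<hook G x. f x r)"
  define b where "b = (\<Prod>x\<in>V. \<Sum>r<hook H x. f x r)"
  have disj: "U \<inter> V = {}" and G: "plane_forest G" and H: "plane_forest H"
    using append.prems(1) by (auto simp: plane_forest_append U_def V_def)
  have fin: "finite U" "finite V" by (simp_all add: U_def V_def)
  have cardA: "card A = card U + card V"
    using append.prems(3) disj fin by (simp add: card_Un_disjoint U_def V_def)
  have below_U: "below (G @ H) u x \<longleftrightarrow> below G u x" if "x \<in> U" for u x
    using that disj by (auto simp: below_append U_def V_def dest: below_verts)
  have below_V: "below (G @ H) u x \<longleftrightarrow> below H u x" if "x \<in> V" for u x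
    using that disj by (auto simp: below_append U_def V_def dest: below_verts)
  have hook_U: "hook (G @ H) x = hook G x" if "x \<in> U" for x
    using that by (simp add: hook_eq below_U U_def)
  have hook_V: "hook (G @ H) x = hook H x" if "x \<in> V" for x
    using that by (simp add: hook_eq below_V V_def)
  have rank_U: "larger_below (G @ H) s x = larger_below G s x" if "x \<in> U" for x and s :: "'a \<Rightarrow> 'b"
    using that by (simp add: larger_below_def below_U)
  have rank_V: "larger_below (G @ H) s x = larger_below H s x" if "x \<in> V" for x and s :: "'a \<Rightarrow> 'b"
    using that by (simp add: larger_below_def below_V)
  let ?g = "\<lambda>s. \<Prod>x\<in>U. f x (larger_below G s x)"
  let ?h = "\<lambda>s. \<Prod>x\<in>V. f x (larger_below H s x)"
  have IH: "of_nat (\<Prod>x\<in>U. hook G x) * (\<Sum>s\<in>bijections U S. ?g s) = of_nat (fact (card U)) * a"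
      "of_nat (\<Prod>x\<in>V. hook H x) * (\<Sum>s\<in>bijections V (A - S). ?h s) = of_nat (fact (card V)) * b"
    if "S \<subseteq> A" "card S = card U" for S
  proof -
    have S: "finite S" using that append.prems(2) finite_subset by blast
    show "of_nat (\<Prod>x\<in>U. hook G x) * (\<Sum>s\<in>bijections U S. ?g s) = of_nat (fact (card U)) * a"
      unfolding U_def a_def by (rule append.IH(1)[OF G S]) (use that in \<open>simp add: U_def\<close>)
    have "card (A - S) = card V" using S that cardA by (simp add: card_Diff_subset)
    then show "of_nat (\<Prod>x\<in>V. hook H x) * (\<Sum>s\<in>bijections V (A - S). ?h s) = of_nat (fact (card V)) * b"
      unfolding V_def b_def using append.prems(2) by (intro append.IH(2)[OF H]) auto
  qed
  have hooks: "(\<Prod>x\<in>U \<union> V. hook (G @ H) x) = (\<Prod>x\<in>U. hook G x) * (\<Prod>x\<in>V. hook H x)"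
    using disj fin by (simp add: prod.union_disjoint hook_U hook_V)
  have sums: "(\<Prod>x\<in>U \<union> V. \<Sum>r<hook (G @ H) x. f x r) = a * b"
    using disj fin by (simp add: prod.union_disjoint hook_U hook_V a_def b_def)
  have "(\<Sum>s\<in>bijections (U \<union> V) A. \<Prod>x\<in>U \<union> V. f x (larger_below (G @ H) s x)) =
      (\<Sum>s\<in>bijections (U \<union> V) A. ?g s * ?h s)"
    using disj fin by (simp add: prod.union_disjoint rank_U rank_V)
  also have "\<dots> = (\<Sum>S | S \<subseteq> A \<and> card S = card U.
      (\<Sum>s\<in>bijections U S. ?g s) * (\<Sum>s\<in>bijections V (A - S). ?h s))"
    by (rule sum_bijections_disjoint_union)
      (use disj fin append.prems(2) in \<open>auto simp: U_def V_def intro!: prod.cong arg_cong[of _ _ "f _"] larger_below_cong\<close>)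
  finally have "of_nat (\<Prod>x\<in>U \<union> V. hook (G @ H) x) *
      (\<Sum>s\<in>bijections (U \<union> V) A. \<Prod>x\<in>U \<union> V. f x (larger_below (G @ H) s x)) =
      (\<Sum>S | S \<subseteq> A \<and> card S = card U.
        (of_nat (\<Prod>x\<in>U. hook G x) * (\<Sum>s\<in>bijections U S. ?g s)) *
        (of_nat (\<Prod>x\<in>V. hook H x) * (\<Sum>s\<in>bijections V (A - S). ?h s)))"
    unfolding hooks of_nat_mult by (simp add: sum_distrib_left mult_ac del: of_nat_prod)
  also have "\<dots> = (\<Sum>S | S \<subseteq> A \<and> card S = card U. (of_nat (fact (card U)) * a) * (of_nat (fact (card V)) * b))"
    by (rule sum.cong) (simp_all add: IH del: of_nat_prod)
  also have "\<dots> = of_nat (card A choose card U) * ((of_nat (fact (card U)) * a) * (of_nat (fact (card V)) * b))"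
    using append.prems(2) by (simp add: n_subsets)
  also have "\<dots> = of_nat (fact (card U) * fact (card V) * (card A choose card U)) * (a * b)"
    by (simp add: mult_ac)
  also have "fact (card U) * fact (card V) * (card A choose card U) = fact (card A)"
    using binomial_fact_lemma[of "card U" "card A"] cardA by simp
  also have "of_nat (fact (card A)) * (a * b) =
      of_nat (fact (card (U \<union> V))) * (\<Prod>x\<in>U \<union> V. \<Sum>r<hook (G @ H) x. f x r)"
    using disj fin by (simp add: sums cardA card_Un_disjoint)
  finally show ?case by (simp add: U_def V_def)
qed

lemma labelings_eq_bijections: "labelings F = bijections (verts F) {1..int (card (verts F))}"
  by (auto simp: labelings_def bijections_def PiE_def bij_betw_def)

lemma sum_prod_larger_below_labelings:
  fixes f :: "'a \<Rightarrow> nat \<Rightarrow> 'c::comm_semiring_1"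
  assumes "plane_forest F"
  shows "of_nat (\<Prod>v\<in>verts F. hook F v) *
      (\<Sum>s\<in>labelings F. \<Prod>v\<in>verts F. f v (larger_below F s v)) =
    of_nat (fact (card (verts F))) * (\<Prod>v\<in>verts F. \<Sum>r<hook F v. f v r)"
  unfolding labelings_eq_bijections using assms by (rule sum_prod_larger_below) simp_all

section \<open>Signed labelings as labelings with a set of negative vertices\<close>

definition with_signs :: "'a set \<Rightarrow> ('a \<Rightarrow> int) \<Rightarrow> 'a \<Rightarrow> int" where
  "with_signs N s v = (if v \<in> N then - s v else s v)"

lemma labelings_pos: "s \<in> labelings F \<Longrightarrow> v \<in> verts F \<Longrightarrow> s v > 0"
  by (fastforce simp: labelings_def PiE_def Pi_def)

lemma abs_with_signs: "s \<in> labelings F \<Longrightarrow> v \<in> verts F \<Longrightarrow> \<bar>with_signs N s v\<bar> = s v"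
  using labelings_pos[of s F v] by (simp add: with_signs_def)

lemma with_signs_neg_iff: "s \<in> labelings F \<Longrightarrow> v \<in> verts F \<Longrightarrow> with_signs N s v < 0 \<longleftrightarrow> v \<in> N"
  using labelings_pos[of s F v] by (simp add: with_signs_def)

text \<open>
  The inverse map takes absolute values and records the vertices with negative label; absolute
  values stay distinct because a signed labeling never uses both \<open>i\<close> and \<open>-i\<close>.
\<close>

lemma bij_betw_with_signs:
  "bij_betw (\<lambda>(s, N). with_signs N s) (labelings F \<times> Pow (verts F)) (labelings_B F)"
proof (rule bij_betw_byWitness[where
    f' = "\<lambda>w. (restrict (\<lambda>v. \<bar>w v\<bar>) (verts F), {v \<in> verts F. w v < 0})"])
  let ?f' = "\<lambda>w. (restrict (\<lambda>v. \<bar>w v\<bar>) (verts F), {v \<in> verts F. w v < 0})"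
  show "\<forall>a\<in>labelings F \<times> Pow (verts F). ?f' (case a of (s, N) \<Rightarrow> with_signs N s) = a"
  proof (rule ballI)
    fix x assume x: "x \<in> labelings F \<times> Pow (verts F)"
    then obtain s N where [simp]: "x = (s, N)" and s: "s \<in> labelings F" and N: "N \<subseteq> verts F"
      by auto
    have "restrict (\<lambda>v. \<bar>with_signs N s v\<bar>) (verts F) = s"
      using s by (auto simp: abs_with_signs fun_eq_iff restrict_def labelings_eq_bijections bijections_def extensional_def)
    moreover have "{v \<in> verts F. with_signs N s v < 0} = N"
      using s N by (auto simp: with_signs_neg_iff)
    ultimately show "?f' (case x of (s, N) \<Rightarrow> with_signs N s) = x" by simp
  qed
  show "\<forall>w\<in>labelings_B F. (case ?f' w of (s, N) \<Rightarrow> with_signs N s) = w"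
    by (auto simp: labelings_B_def with_signs_def fun_eq_iff PiE_def extensional_def)
  show "(\<lambda>(s, N). with_signs N s) ` (labelings F \<times> Pow (verts F)) \<subseteq> labelings_B F"
  proof (rule image_subsetI)
    fix x assume x: "x \<in> labelings F \<times> Pow (verts F)"
    then obtain s N where [simp]: "x = (s, N)" and s: "s \<in> labelings F" and N: "N \<subseteq> verts F"
      by auto
    let ?w = "with_signs N s"
    have inj: "inj_on s (verts F)" using s by (auto simp: labelings_def bij_betw_def)
    have eq: "u = v" if "u \<in> verts F" "v \<in> verts F" "\<bar>?w u\<bar> = \<bar>?w v\<bar>" for u v
      using that s inj by (simp add: abs_with_signs inj_on_def)
    have w0: "?w v \<noteq> 0" if "v \<in> verts F" for v
      using labelings_pos[OF s that] by (simp add: with_signs_def)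
    have "?w \<in> verts F \<rightarrow>\<^sub>E {- int (card (verts F))..int (card (verts F))} - {0}"
    proof (rule PiE_I)
      fix v assume v: "v \<in> verts F"
      then have "s v \<in> {1..int (card (verts F))}" using s by (auto simp: labelings_def PiE_def)
      then show "?w v \<in> {- int (card (verts F))..int (card (verts F))} - {0}"
        by (auto simp: with_signs_def)
    next
      fix v assume "v \<notin> verts F"
      then show "?w v = undefined"
        using s N by (auto simp: with_signs_def labelings_def PiE_def extensional_def)
    qed
    moreover have "inj_on ?w (verts F)" using eq by (auto simp: inj_on_def)
    moreover have "- i \<notin> ?w ` verts F" if i: "i \<in> ?w ` verts F" for i
    proof
      assume "- i \<in> ?w ` verts F"
      with i obtain u v where uv: "u \<in> verts F" "v \<in> verts F" "?w u = i" "?w v = - i" by fastforce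
      then have "u = v" by (intro eq) auto
      then show False using uv w0[of u] by simp
    qed
    ultimately have "?w \<in> labelings_B F" unfolding labelings_B_def by blast
    then show "(case x of (s, N) \<Rightarrow> with_signs N s) \<in> labelings_B F" by simp
  qed
  show "?f' ` labelings_B F \<subseteq> labelings F \<times> Pow (verts F)"
  proof (rule image_subsetI)
    fix w assume w: "w \<in> labelings_B F"
    let ?n = "int (card (verts F))" and ?s = "restrict (\<lambda>v. \<bar>w v\<bar>) (verts F)"
    have range: "w v \<in> {- ?n..?n} - {0}" if "v \<in> verts F" for v
      using w that by (auto simp: labelings_B_def PiE_def Pi_def)
    have inj: "inj_on w (verts F)" and sgn: "\<And>i. i \<in> w ` verts F \<Longrightarrow> - i \<notin> w ` verts F"
      using w by (auto simp: labelings_B_def)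
    have "inj_on ?s (verts F)"
    proof (rule inj_onI)
      fix u v assume uv: "u \<in> verts F" "v \<in> verts F" "?s u = ?s v"
      then have "\<bar>w u\<bar> = \<bar>w v\<bar>" by simp
      moreover have "w u \<noteq> - w v" using sgn[of "w v"] uv by force
      ultimately have "w u = w v" by (auto simp: abs_eq_iff)
      then show "u = v" using inj uv by (auto dest: inj_onD)
    qed
    moreover from this have "?s ` verts F = {1..?n}"
      by (intro card_subset_eq) (use range in \<open>force simp: card_image\<close>)+
    ultimately have "bij_betw ?s (verts F) {1..?n}" by (simp add: bij_betw_def)
    moreover have "?s \<in> extensional (verts F)" by simp
    ultimately show "?f' w \<in> labelings F \<times> Pow (verts F)"
      by (auto simp: labelings_eq_bijections bijections_def)
  qed
qed

lemma n1_with_signs: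
  assumes "s \<in> labelings F" "N \<subseteq> verts F"
  shows "n1 F (with_signs N s) = card N"
proof -
  have "{v \<in> verts F. with_signs N s v < 0} = N"
    using assms by (auto simp: with_signs_neg_iff)
  then show ?thesis by (simp add: n1_def)
qed

section \<open>Inversions and maxima vertex by vertex\<close>

lemma card_below_pairs:
  "card {(u, v). below F u v \<and> P u v} = (\<Sum>v\<in>verts F. card {u. below F u v \<and> P u v})"
proof -
  have "{(u, v). below F u v \<and> P u v} = prod.swap ` (SIGMA v:verts F. {u. below F u v \<and> P u v})"
    by (auto dest: below_verts)
  then show ?thesis by (simp add: card_image)
qed

lemma inv_F_eq_sum: "inv_F F w = (\<Sum>v\<in>verts F. larger_below F w v)"
  unfolding inv_F_def larger_below_def by (rule card_below_pairs)

text \<open>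
  Write \<open>w\<close> for \<open>with_signs N s\<close>, fix \<open>v\<close> and let \<open>u\<close> run over the vertices
  below it.  If \<open>\<bar>w u\<bar> > \<bar>w v\<bar>\<close>, then exactly one of
  \<open>w u > w v\<close> and \<open>w u + w v < 0\<close> holds, depending on the sign of \<open>w u\<close>.  If \<open>\<bar>w u\<bar> < \<bar>w v\<bar>\<close>,
  then none or both of them hold, according to the sign of \<open>w v\<close>.  So the contribution of \<open>v\<close>
  depends, besides the absolute values, on the sign of \<open>w v\<close> only: with \<open>r\<close> the number of larger
  absolute values below \<open>v\<close>, it is \<open>r\<close> when \<open>w v > 0\<close> and
  \<open>r + 2 * (hook F v - 1 - r)\<close> when \<open>w v < 0\<close>.
\<close>

lemma inv_F_plus_n2_with_signs:
  assumes s: "s \<in> labelings F"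
  shows "inv_F F (with_signs N s) + n2 F (with_signs N s) =
    (\<Sum>v\<in>verts F. if v \<in> N then 2 * hook F v - 2 - larger_below F s v else larger_below F s v)"
proof -
  let ?w = "with_signs N s"
  have pointwise: "card {u. below F u v \<and> ?w v < ?w u} + card {u. below F u v \<and> ?w u + ?w v < 0} =
      (if v \<in> N then 2 * hook F v - 2 - larger_below F s v else larger_below F s v)"
    (is "card ?I + card ?M = _") if v: "v \<in> verts F" for v
  proof -
    have pos: "s v > 0" "\<And>u. below F u v \<Longrightarrow> s u > 0"
      using v s by (auto intro: labelings_pos dest: below_verts)
    have ne: "s u \<noteq> s v" if "below F u v" for u
      using that s v below_verts[OF that]
      by (auto simp: labelings_def bij_betw_def below_def dest: inj_onD)
    let ?L = "{u. below F u v \<and> s v < s u}" and ?S = "{u. below F u v \<and> s u < s v}"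
    have split: "card {u. below F u v} = card ?L + card ?S"
    proof -
      have "{u. below F u v} = ?L \<union> ?S" using ne by force
      moreover have "?L \<inter> ?S = {}" by auto
      ultimately show ?thesis by (simp add: card_Un_disjoint)
    qed
    show ?thesis
    proof (cases "v \<in> N")
      case True
      \<comment> \<open>For \<open>w v < 0\<close> the two conditions read \<open>w u > - s v\<close> and \<open>w u < s v\<close>.\<close>
      have "?I \<union> ?M = {u. below F u v}" "?I \<inter> ?M = ?S"
        using True pos by (auto simp: with_signs_def) (smt (verit) pos)+
      then have "card ?I + card ?M = card {u. below F u v} + card ?S"
        by (subst card_Un_Int) auto
      then show ?thesis using True v split by (simp add: hook_eq larger_below_def)
    next
      case False
      have "?I \<union> ?M = ?L" "?I \<inter> ?M = {}"
        using False pos by (auto simp: with_signs_def split: if_splits) (smt (verit) pos)+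
      then have "card ?I + card ?M = card ?L"
        by (subst card_Un_Int) auto
      then show ?thesis using False by (simp add: larger_below_def)
    qed
  qed
  show ?thesis
    unfolding inv_F_def n2_def card_below_pairs sum.distrib[symmetric]
    by (rule sum.cong) (simp_all add: pointwise)
qed

lemma larger_below_eq_0_iff: "larger_below F w v = 0 \<longleftrightarrow> (\<forall>u. below F u v \<longrightarrow> \<not> w v < w u)"
  by (simp add: larger_below_def)

lemma larger_below_0_labeling:
  assumes s: "s \<in> labelings F" and v: "v \<in> verts F"
  shows "larger_below F s v = 0 \<longleftrightarrow> (\<forall>u. below F u v \<longrightarrow> s u < s v)"
proof -
  have "s u \<noteq> s v" if "below F u v" for u
    using that s v below_verts[OF that]
    by (auto simp: labelings_def bij_betw_def below_def dest: inj_onD)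
  then show ?thesis by (force simp: larger_below_eq_0_iff)
qed

lemma Btmax_labeling:
  "s \<in> labelings F \<Longrightarrow> Btmax F s = {v \<in> verts F. larger_below F s v = 0}"
  by (auto simp: Btmax_def larger_below_0_labeling)

lemma Btmax_B_with_signs:
  assumes s: "s \<in> labelings F"
  shows "Btmax_B F (with_signs N s) = {v \<in> verts F. v \<notin> N \<and> larger_below F s v = 0}"
proof -
  have "with_signs N s v > 0 \<and> (\<forall>u. below F u v \<longrightarrow> with_signs N s v > \<bar>with_signs N s u\<bar>) \<longleftrightarrow>
      v \<notin> N \<and> larger_below F s v = 0" if v: "v \<in> verts F" for v
  proof -
    have "with_signs N s v > 0 \<longleftrightarrow> v \<notin> N"
      using labelings_pos[OF s v] by (simp add: with_signs_def)
    moreover have "\<bar>with_signs N s u\<bar> = s u" if "below F u v" for u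
      using that s by (auto simp: abs_with_signs dest: below_verts)
    ultimately show ?thesis
      using v s by (auto simp: larger_below_0_labeling with_signs_def)
  qed
  then show ?thesis unfolding Btmax_B_def by blast
qed

lemma Btmax_D_eq: "Btmax_D F w = {v \<in> Btmax_B F w. \<not> leaf F v}"
  by (auto simp: Btmax_D_def Btmax_B_def)

text \<open>
  The contribution of a vertex \<open>v\<close> that carries a positive label and has \<open>r\<close> larger absolute
  values below it: such a vertex is a bottom-to-top maximum exactly when \<open>r = 0\<close>.  The
  predicate \<open>P\<close> singles out the vertices whose maxima are marked: all of them, or the
  non-leaves for even-signed labelings.
\<close>

definition max_weight :: "('a \<Rightarrow> bool) \<Rightarrow> 'a \<Rightarrow> nat \<Rightarrow> 'a qt_poly" where
  "max_weight P v r = q_var ^ r * (if r = 0 \<and> P v then t_var v else 1)"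

lemma weight_labeling:
  assumes "s \<in> labelings F"
  shows "q_var ^ inv_F F s * (\<Prod>v\<in>Btmax F s. t_var v) =
    (\<Prod>v\<in>verts F. max_weight (\<lambda>_. True) v (larger_below F s v))"
  using assms
  by (simp add: inv_F_eq_sum Btmax_labeling prod.inter_filter power_sum max_weight_def prod.distrib)

lemma weight_with_signs_D:
  assumes "s \<in> labelings F"
  shows "q_var ^ inv_D F (with_signs N s) * (\<Prod>v\<in>Btmax_D F (with_signs N s). t_var v) =
    (\<Prod>v\<in>verts F. if v \<in> N then q_var ^ (2 * hook F v - 2 - larger_below F s v)
       else max_weight (\<lambda>v. \<not> leaf F v) v (larger_below F s v))"
  unfolding inv_D_def inv_F_plus_n2_with_signs[OF assms] power_sum Btmax_D_eq
    Btmax_B_with_signs[OF assms]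
  by (auto simp: prod.inter_filter prod.distrib[symmetric] max_weight_def intro!: prod.cong)

lemma weight_with_signs_B:
  assumes s: "s \<in> labelings F" and N: "N \<subseteq> verts F"
  shows "q_var ^ inv_B F (with_signs N s) * (\<Prod>v\<in>Btmax_B F (with_signs N s). t_var v) =
    (\<Prod>v\<in>verts F. if v \<in> N then q_var ^ Suc (2 * hook F v - 2 - larger_below F s v)
       else max_weight (\<lambda>_. True) v (larger_below F s v))"
proof -
  have "card N = (\<Sum>v\<in>verts F. if v \<in> N then 1 else 0)"
    using N by (simp add: sum.If_cases Int_absorb1)
  then have inv_B: "inv_B F (with_signs N s) = (\<Sum>v\<in>verts F.
      if v \<in> N then Suc (2 * hook F v - 2 - larger_below F s v) else larger_below F s v)"
  proof -
    have "inv_B F (with_signs N s) = (inv_F F (with_signs N s) + n2 F (with_signs N s)) + card N"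
      by (simp add: inv_B_def n1_with_signs[OF s N])
    then show ?thesis
      unfolding inv_F_plus_n2_with_signs[OF s] \<open>card N = _\<close> sum.distrib[symmetric]
      by (auto intro!: sum.cong)
  qed
  show ?thesis
    unfolding inv_B power_sum Btmax_B_with_signs[OF s]
    by (auto simp: prod.inter_filter prod.distrib[symmetric] max_weight_def intro!: prod.cong)
qed

section \<open>Summation over the signs\<close>

lemma sum_Pow_signs:
  fixes p m :: "'a \<Rightarrow> 'c::comm_semiring_1"
  assumes "finite V"
  shows "(\<Sum>N\<in>Pow V. \<Prod>v\<in>V. if v \<in> N then m v else p v) = (\<Prod>v\<in>V. m v + p v)"
proof -
  have "(\<Prod>v\<in>V. if v \<in> N then m v else p v) = (\<Prod>v\<in>N. m v) * (\<Prod>v\<in>V - N. p v)" if "N \<subseteq> V" for N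
    using assms that by (simp add: prod.If_cases Int_absorb1 Diff_eq)
  then show ?thesis using prod_add[OF assms, of m p] by simp
qed

text \<open>
  Summing over even sets only gives half of the full sum as soon as one vertex \<open>l\<close> is
  indifferent to its sign: weighting each set with \<open>(-1) ^ card N\<close> amounts to replacing \<open>m\<close>
  by \<open>-m\<close>, and then the factor at \<open>l\<close> vanishes.
\<close>

lemma sum_even_Pow_signs:
  fixes p m :: "'a \<Rightarrow> 'c::comm_ring_1"
  assumes V: "finite V" and l: "l \<in> V" "m l = p l"
  shows "2 * (\<Sum>N | N \<subseteq> V \<and> even (card N). \<Prod>v\<in>V. if v \<in> N then m v else p v) = (\<Prod>v\<in>V. m v + p v)"
proof -
  let ?g = "\<lambda>N. \<Prod>v\<in>V. if v \<in> N then m v else p v"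
  have signed: "(\<Prod>v\<in>V. if v \<in> N then - m v else p v) = (-1) ^ card N * ?g N" if "N \<subseteq> V" for N
    using V that by (simp add: prod.If_cases Int_absorb1 prod_uminus)
  have "0 = (\<Prod>v\<in>V. - m v + p v)"
    by (rule prod_zero[symmetric]) (use V l in \<open>auto intro!: bexI[of _ l]\<close>)
  also have "\<dots> = (\<Sum>N\<in>Pow V. (-1) ^ card N * ?g N)"
    unfolding sum_Pow_signs[OF V, of "\<lambda>v. - m v" p, symmetric] by (rule sum.cong) (simp_all add: signed)
  finally have "(\<Prod>v\<in>V. m v + p v) = (\<Sum>N\<in>Pow V. ?g N + (-1) ^ card N * ?g N)"
    by (simp add: sum.distrib sum_Pow_signs[OF V])
  also have "\<dots> = (\<Sum>N\<in>Pow V. if even (card N) then 2 * ?g N else 0)"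
    by (rule sum.cong) auto
  also have "\<dots> = (\<Sum>N | N \<in> Pow V \<and> even (card N). 2 * ?g N)"
    using V by (subst sum.inter_filter) simp_all
  finally show ?thesis by (simp add: sum_distrib_left)
qed

section \<open>Summation over the local inversion numbers\<close>

lemma q_number_add: "q_number (a + b) = q_number a + q_var ^ a * q_number b"
  by (induction b) (simp_all add: q_number_def algebra_simps power_add)

lemma sum_max_weight:
  assumes "h > 0"
  shows "(\<Sum>r<h. max_weight P v r) = (if P v then q_number h - 1 + t_var v else q_number h)"
proof -
  obtain k where h: "h = Suc k" using assms by (cases h) auto
  show ?thesis unfolding h q_number_def sum.lessThan_Suc_shift by (simp add: max_weight_def)
qed

text \<open>
  As \<open>r\<close> runs through \<open>{..<h}\<close>, the exponents of the negative labels fill \<open>{h - 1..2 * h - 2}\<close>.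
\<close>

lemma sum_negative_weight:
  "(\<Sum>r<h. q_var ^ (2 * h - 2 - r)) = q_var ^ (h - 1) * q_number h"
proof -
  have "(\<Sum>r<h. q_var ^ (2 * h - 2 - r)) = (\<Sum>r<h. q_var ^ (h - 1) * q_var ^ (h - Suc r))"
    by (rule sum.cong) (auto simp flip: power_add intro!: arg_cong[of _ _ "power _"])
  also have "\<dots> = q_var ^ (h - 1) * q_number h"
    by (simp add: sum_distrib_left[symmetric] q_number_def sum.nat_diff_reindex)
  finally show ?thesis .
qed

text \<open>
  Counting the negative label itself shifts the exponents to \<open>{h..2 * h - 1}\<close>, directly above
  the exponents \<open>{..<h}\<close> of the positive labels; together they make up \<open>q_number (2 * h)\<close>.
\<close>

lemma sum_negative_weight_B:
  assumes "h > 0"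
  shows "(\<Sum>r<h. q_var ^ Suc (2 * h - 2 - r)) = q_var ^ h * q_number h"
proof -
  have "(\<Sum>r<h. q_var ^ Suc (2 * h - 2 - r)) = (q_var * q_var ^ (h - 1)) * q_number h"
    by (simp only: power_Suc sum_distrib_left[symmetric] sum_negative_weight mult.assoc)
  also have "q_var * q_var ^ (h - 1) = q_var ^ h"
    using assms by (cases h) simp_all
  finally show ?thesis .
qed

lemma hook_pos: "v \<in> verts F \<Longrightarrow> hook F v > 0"
  by (simp add: hook_eq)

lemma hook_leaf: "leaf F v \<Longrightarrow> hook F v = 1"
  by (simp add: hook_eq leaf_def)

section \<open>The three hook product formulas\<close>

lemma ex_leaf: "F \<noteq> [] \<Longrightarrow> plane_forest F \<Longrightarrow> \<exists>v. leaf F v"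
proof (induction F rule: forest_induct)
  case (Node v cs)
  show ?case
  proof (cases "cs = []")
    case True
    then have "leaf [Node v cs] v" by (auto simp: leaf_def below_Node verts_def below_def)
    then show ?thesis ..
  next
    case False
    then obtain l where "leaf cs l" using Node by (auto simp: plane_forest_Node)
    then have "leaf [Node v cs] l" using Node.prems(2) by (auto simp: leaf_def below_Node plane_forest_Node)
    then show ?thesis ..
  qed
next
  case (append G H)
  then consider l where "leaf G l" | l where "leaf H l"
    by (auto simp: plane_forest_append)
  then show ?case
  proof cases
    case 1
    then have "\<not> below H u l" for u
      using append.prems(2) below_verts[of H u l] by (auto simp: leaf_def plane_forest_append)
    with 1 have "leaf (G @ H) l" by (simp add: leaf_def below_append)
    then show ?thesis ..
  next
    case 2
    then have "\<not> below G u l" for u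
      using append.prems(2) below_verts[of G u l] by (auto simp: leaf_def plane_forest_append)
    with 2 have "leaf (G @ H) l" by (simp add: leaf_def below_append)
    then show ?thesis ..
  qed
qed simp

text \<open>
  The hook formulas are first derived without denominators, in which form they make sense over
  any commutative ring; rational coefficients enter only here.
\<close>

lemma eq_const_poly_quotient:
  assumes "of_nat d * X = of_nat m * Y" "d \<noteq> 0"
  shows "X = const_poly (of_nat m / of_nat d) * Y"
proof -
  have of_nat: "of_nat k = const_poly (of_nat k)" for k :: nat
    by (simp add: const_poly_def)
  have mult: "const_poly a * const_poly b = const_poly (a * b)" for a b
    by (simp add: const_poly_def mult_single)
  have one: "const_poly 1 = 1" by (simp add: const_poly_def)
  have "X = const_poly (1 / of_nat d) * (of_nat d * X)"
    using assms(2) by (simp add: of_nat mult mult.assoc[symmetric] one)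
  also have "\<dots> = const_poly (of_nat m / of_nat d) * Y"
    unfolding assms(1) by (simp add: of_nat mult mult.assoc[symmetric])
  finally show ?thesis .
qed

lemma sum_labelings_B:
  "(\<Sum>w\<in>labelings_B F. g w) = (\<Sum>s\<in>labelings F. \<Sum>N\<in>Pow (verts F). g (with_signs N s))"
  using sum.reindex_bij_betw[OF bij_betw_with_signs, of g F]
  by (simp add: sum.cartesian_product case_prod_unfold)

lemma sum_labelings_D:
  "(\<Sum>w\<in>labelings_D F. g w) =
    (\<Sum>s\<in>labelings F. \<Sum>N | N \<subseteq> verts F \<and> even (card N). g (with_signs N s))"
proof -
  have fin: "finite (labelings_B F)"
    unfolding bij_betw_finite[OF bij_betw_with_signs, of F, symmetric] labelings_eq_bijections
    by (intro finite_cartesian_product finite_bijections finite_Pow_iff[THEN iffD2]) simp_all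
  have "(\<Sum>w\<in>labelings_D F. g w) = (\<Sum>w\<in>labelings_B F. if even (n1 F w) then g w else 0)"
    unfolding labelings_D_def using fin by (rule sum.inter_filter)
  also have "\<dots> = (\<Sum>s\<in>labelings F. \<Sum>N\<in>Pow (verts F). if even (card N) then g (with_signs N s) else 0)"
    by (simp add: sum_labelings_B n1_with_signs)
  also have "\<dots> = (\<Sum>s\<in>labelings F. \<Sum>N | N \<in> Pow (verts F) \<and> even (card N). g (with_signs N s))"
    by (subst sum.inter_filter) simp_all
  finally show ?thesis by simp
qed

lemma hook_product_labelings:
  assumes "plane_forest F"
  shows "of_nat (\<Prod>v\<in>verts F. hook F v) *
      (\<Sum>w\<in>labelings F. q_var ^ inv_F F w * (\<Prod>v\<in>Btmax F w. t_var v)) =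
    of_nat (fact (card (verts F))) * (\<Prod>v\<in>verts F. q_number (hook F v) - 1 + t_var v)"
  using sum_prod_larger_below_labelings[OF assms, of "max_weight (\<lambda>_. True)"]
  by (simp add: weight_labeling sum_max_weight hook_pos)

lemma hook_product_labelings_B:
  assumes "plane_forest F"
  shows "of_nat (\<Prod>v\<in>verts F. hook F v) *
      (\<Sum>w\<in>labelings_B F. q_var ^ inv_B F w * (\<Prod>v\<in>Btmax_B F w. t_var v)) =
    of_nat (fact (card (verts F))) * (\<Prod>v\<in>verts F. q_number (2 * hook F v) - 1 + t_var v)"
proof -
  let ?f = "\<lambda>v r. q_var ^ Suc (2 * hook F v - 2 - r) + max_weight (\<lambda>_. True) v r :: 'a qt_poly"
  have "(\<Sum>w\<in>labelings_B F. q_var ^ inv_B F w * (\<Prod>v\<in>Btmax_B F w. t_var v)) =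
      (\<Sum>s\<in>labelings F. \<Prod>v\<in>verts F. ?f v (larger_below F s v))"
    by (simp add: sum_labelings_B weight_with_signs_B sum_Pow_signs del: power_Suc)
  moreover have "(\<Sum>r<hook F v. ?f v r) = q_number (2 * hook F v) - 1 + t_var v" if "v \<in> verts F" for v
    unfolding sum.distrib sum_negative_weight_B[OF hook_pos[OF that]] sum_max_weight[OF hook_pos[OF that]]
    by (simp add: mult_2 q_number_add)
  ultimately show ?thesis
    using sum_prod_larger_below_labelings[OF assms, of ?f] by simp
qed

text \<open>
  A leaf has no vertex below it, so neither \<^const>\<open>inv_D\<close> nor \<^const>\<open>Btmax_D\<close> depends on the sign of
  its label.  Hence the even-signed labelings contribute exactly half of the sum over all signed
  labelings, and each leaf accounts for a factor 2 in the latter.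
\<close>

lemma hook_product_labelings_D:
  assumes "plane_forest F" "F \<noteq> []"
  shows "of_nat (2 * (\<Prod>v\<in>verts F. hook F v)) *
      (\<Sum>w\<in>labelings_D F. q_var ^ inv_D F w * (\<Prod>v\<in>Btmax_D F w. t_var v)) =
    of_nat (fact (card (verts F)) * 2 ^ card {v. leaf F v}) *
      (\<Prod>v\<in>{v \<in> verts F. \<not> leaf F v}.
        (1 + q_var ^ (hook F v - 1)) * q_number (hook F v) - 1 + t_var v)"
proof -
  let ?p = "max_weight (\<lambda>v. \<not> leaf F v)"
  let ?m = "\<lambda>v r. q_var ^ (2 * hook F v - 2 - r) :: 'a qt_poly"
  let ?t = "\<lambda>v. (1 + q_var ^ (hook F v - 1)) * q_number (hook F v) - 1 + t_var v :: 'a qt_poly"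
  let ?r = "larger_below F"
  let ?S = "\<Sum>w\<in>labelings_D F. q_var ^ inv_D F w * (\<Prod>v\<in>Btmax_D F w. t_var v)"
  obtain l where l: "leaf F l" using ex_leaf assms by blast
  then have l_V: "l \<in> verts F" by (simp add: leaf_def)
  have "?r s l = 0" for s :: "'a \<Rightarrow> int" using l by (simp add: larger_below_def leaf_def)
  then have m_l: "?m l (?r s l) = ?p l (?r s l)" for s :: "'a \<Rightarrow> int"
    using l hook_leaf[OF l] by (simp add: max_weight_def)
  have "2 * ?S = (\<Sum>s\<in>labelings F. 2 * (\<Sum>N | N \<subseteq> verts F \<and> even (card N).
      \<Prod>v\<in>verts F. if v \<in> N then ?m v (?r s v) else ?p v (?r s v)))"
    unfolding sum_labelings_D sum_distrib_left[of 2 _ "labelings F"]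
    by (intro sum.cong refl arg_cong[of _ _ "times 2"]) (rule weight_with_signs_D)
  also have "\<dots> = (\<Sum>s\<in>labelings F. \<Prod>v\<in>verts F. ?m v (?r s v) + ?p v (?r s v))"
    by (intro sum.cong refl sum_even_Pow_signs[OF finite_verts l_V] m_l)
  finally have double: "2 * ?S = \<dots>" .
  have factor: "(\<Sum>r<hook F v. ?m v r + ?p v r) = (if leaf F v then 2 else ?t v)" if "v \<in> verts F" for v
  proof (cases "leaf F v")
    case True
    then show ?thesis using hook_leaf[OF True] by (simp add: max_weight_def)
  next
    case False
    then show ?thesis
      unfolding sum.distrib sum_negative_weight sum_max_weight[OF hook_pos[OF that]]
      by (simp add: algebra_simps)
  qed
  have leaves: "(\<Prod>v\<in>verts F. if leaf F v then 2 else ?t v) =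
      2 ^ card {v. leaf F v} * (\<Prod>v\<in>{v \<in> verts F. \<not> leaf F v}. ?t v)"
  proof -
    have "verts F \<inter> {v. leaf F v} = {v. leaf F v}" by (auto simp: leaf_def)
    moreover have "verts F \<inter> - {v. leaf F v} = {v \<in> verts F. \<not> leaf F v}" by auto
    ultimately show ?thesis by (simp only: prod.If_cases finite_verts prod_constant)
  qed
  have "of_nat (\<Prod>v\<in>verts F. hook F v) * (2 * ?S) =
      of_nat (fact (card (verts F))) * (\<Prod>v\<in>verts F. \<Sum>r<hook F v. ?m v r + ?p v r)"
    unfolding double by (rule sum_prod_larger_below_labelings[OF assms(1)])
  also have "(\<Prod>v\<in>verts F. \<Sum>r<hook F v. ?m v r + ?p v r) =
      2 ^ card {v. leaf F v} * (\<Prod>v\<in>{v \<in> verts F. \<not> leaf F v}. ?t v)"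
    unfolding leaves[symmetric] by (rule prod.cong[OF refl factor])
  finally show ?thesis
    by (simp only: of_nat_mult of_nat_power of_nat_numeral mult_ac)
qed

theorem corollary2p7:
  fixes F :: "'a forest" and n :: nat
  assumes "plane_forest F" and "n = card (verts F)" and "n \<ge> 1"
  shows "((\<Sum>w\<in>labelings F. q_var ^ inv_F F w * (\<Prod>v\<in>Btmax F w. t_var v))
           = const_poly (fact n / (\<Prod>v\<in>verts F. of_nat (hook F v)))
             * (\<Prod>v\<in>verts F. q_number (hook F v) - 1 + t_var v))
     \<and> ((\<Sum>w\<in>labelings_B F. q_var ^ inv_B F w * (\<Prod>v\<in>Btmax_B F w. t_var v))
           = const_poly (fact n / (\<Prod>v\<in>verts F. of_nat (hook F v)))
             * (\<Prod>v\<in>verts F. q_number (2 * hook F v) - 1 + t_var v))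
     \<and> ((\<Sum>w\<in>labelings_D F. q_var ^ inv_D F w * (\<Prod>v\<in>Btmax_D F w. t_var v))
           = const_poly (fact n * 2 ^ (card {v. leaf F v} - 1)
                         / (\<Prod>v\<in>verts F. of_nat (hook F v)))
             * (\<Prod>v\<in>{v \<in> verts F. \<not> leaf F v}.
                  (1 + q_var ^ (hook F v - 1)) * q_number (hook F v) - 1 + t_var v))"
proof -
  define d where "d = (\<Prod>v\<in>verts F. hook F v)"
  have d: "d \<noteq> 0" using hook_pos by (fastforce simp: d_def)
  have d_rat: "(\<Prod>v\<in>verts F. of_nat (hook F v)) = (of_nat d :: rat)" by (simp add: d_def)
  have F: "F \<noteq> []" using assms(2,3) by (auto simp: verts_def)
  have half: "of_nat (fact n * 2 ^ card {v. leaf F v}) / of_nat (2 * d) =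
      (fact n * 2 ^ (card {v. leaf F v} - 1) / of_nat d :: rat)"
  proof -
    have "{v. leaf F v} \<noteq> {}" using ex_leaf[OF F assms(1)] by blast
    moreover have "finite {v. leaf F v}"
      by (rule finite_subset[of _ "verts F"]) (auto simp: leaf_def)
    ultimately obtain k where "card {v. leaf F v} = Suc k"
      by (metis card_eq_0_iff not0_implies_Suc)
    then show ?thesis using d by simp
  qed
  note labelings = hook_product_labelings[OF assms(1), folded d_def assms(2)]
    and signed = hook_product_labelings_B[OF assms(1), folded d_def assms(2)]
    and even_signed = hook_product_labelings_D[OF assms(1) F, folded d_def assms(2)]
  show ?thesis
    using eq_const_poly_quotient[OF labelings d] eq_const_poly_quotient[OF signed d]
      eq_const_poly_quotient[OF even_signed] d
    unfolding d_rat half of_nat_fact by simp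
qed

end
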